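(* Let $\alpha,\beta,\gamma>-1$ with $\alpha-\beta\notin\mathbb Z$. The Jacobi–Piñeiro multiple orthogonal polynomials of type I on the step-line are $$A^{\alpha,\beta,\gamma}_{(n,n),1}(x)=A^{\beta,\alpha,\gamma}_{(n,n),2}(x)=\frac{(2n+\alpha+\gamma)_n(2n+\beta+\gamma)_n}{(n-1)!\,\Gamma(2n+\gamma)}\sum_{j=0}^{n-1}(-1)^j\binom{n-1}{j}\frac{\Gamma(3n-(j+1)+\alpha+\gamma)}{\Gamma(n-j+\alpha)\,(\alpha-\beta-j)_n}\,x^{n-1-j},\quad n\in\mathbb N,$$ $$A^{\alpha,\beta,\gamma}_{(n+1,n),1}(x)=\frac{\Gamma(3n+2+\alpha+\gamma)(2n+1+\beta+\gamma)_n}{n!\,\Gamma(2n+1+\gamma)}\sum_{j=0}^{n}(-1)^j\binom nj\frac{(2n+1+\alpha+\gamma)_{n-j}}{\Gamma(\alpha+n+1-j)\,(\alpha-\beta+1-j)_n}\,x^{n-j},\quad n\in\mathbb N_0,$$ $$A^{\alpha,\beta,\gamma}_{(n+1,n),2}(x)=(-1)^{n-1}\frac{\Gamma(3n+1+\beta+\gamma)(2n+1+\alpha+\gamma)_{n+1}}{(n-1)!\,\Gamma(2n+1+\gamma)}\sum_{j=0}^{n-1}(-1)^j\binom{n-1}j\frac{(2n+1+\beta+\gamma)_{n-1-j}}{\Gamma(\beta+n-j)\,(\alpha-\beta-(n-1)+j)_{n+1}}\,x^{n-1-j},\quad n\in\mathbb N.$$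
   Context: For $\vec\nu=(\nu_1,\nu_2)\in\mathbb N_0^2$, $|\vec\nu|=\nu_1+\nu_2\ge1$, the type I Jacobi–Piñeiro polynomials $A_{\vec\nu,1}=A^{\alpha,\beta,\gamma}_{\vec\nu,1}$, $A_{\vec\nu,2}=A^{\alpha,\beta,\gamma}_{\vec\nu,2}$ are the polynomials with $\deg A_{\vec\nu,a}\le\nu_a-1$ (with $A_{\vec\nu,a}=0$ if $\nu_a=0$) determined by $$\int_0^1\big(A_{\vec\nu,1}(x)x^\alpha+A_{\vec\nu,2}(x)x^\beta\big)(1-x)^\gamma x^j\,dx=\begin{cases}0,&0\le j\le|\vec\nu|-2,\\1,&j=|\vec\nu|-1.\end{cases}$$ The step-line consists of the multi-indices $(n,n)$ and $(n+1,n)$. The Pochhammer symbol is $(z)_k=z(z+1)\cdots(z+k-1)$, $(z)_0=1$. In the first formula, $A^{\beta,\alpha,\gamma}_{(n,n),2}$ denotes $A_{(n,n),2}$ with $\alpha$ and $\beta$ interchanged. *)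

theory Defs
  imports "HOL-Analysis.Analysis" "HOL-Computational_Algebra.Polynomial"
begin

text \<open>
  The degree constraint \<open>deg A \<le> k - 1\<close>, where \<open>k = 0\<close> forces the zero polynomial; it has to be
  split into cases because subtraction on \<^typ>\<open>nat\<close> is truncated.
\<close>

definition deg_constraint :: "nat \<Rightarrow> real poly \<Rightarrow> bool" where
  "deg_constraint k A \<longleftrightarrow> (if k = 0 then A = 0 else degree A \<le> k - 1)"

text \<open>
  The orthogonality range \<open>0 \<le> j \<le> \<bar>\<nu>\<bar> - 2\<close> is written \<open>j + 2 \<le> \<bar>\<nu>\<bar>\<close>, so that it is empty for
  \<open>\<bar>\<nu>\<bar> = 1\<close>.  The convention \<open>0 powr a = 0\<close> only affects the integrand at the
  end points, and \<open>has_integral\<close> asserts that the integral exists.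
\<close>

definition is_jacobi_pineiro_I ::
  "real \<Rightarrow> real \<Rightarrow> real \<Rightarrow> nat \<times> nat \<Rightarrow> real poly \<times> real poly \<Rightarrow> bool" where
  "is_jacobi_pineiro_I \<alpha> \<beta> \<gamma> \<nu> A \<longleftrightarrow>
     (let N = fst \<nu> + snd \<nu>;
          f = (\<lambda>j x. (poly (fst A) x * x powr \<alpha> + poly (snd A) x * x powr \<beta>)
                       * (1 - x) powr \<gamma> * x ^ j)
      in deg_constraint (fst \<nu>) (fst A) \<and> deg_constraint (snd \<nu>) (snd A) \<and>
         (\<forall>j::nat. j + 2 \<le> N \<longrightarrow> (f j has_integral 0) {0..1}) \<and>
         (\<forall>j::nat. j + 1 = N \<longrightarrow> (f j has_integral 1) {0..1}))"

text \<open>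
  The description below says nothing unless the pair is unique, so an identity with an explicit
  polynomial contains both existence and uniqueness.
\<close>

definition jacobi_pineiro_I ::
  "real \<Rightarrow> real \<Rightarrow> real \<Rightarrow> nat \<times> nat \<Rightarrow> real poly \<times> real poly" where
  "jacobi_pineiro_I \<alpha> \<beta> \<gamma> \<nu> = (THE A. is_jacobi_pineiro_I \<alpha> \<beta> \<gamma> \<nu> A)"

definition JP1 :: "real \<Rightarrow> real \<Rightarrow> real \<Rightarrow> nat \<times> nat \<Rightarrow> real poly" where
  "JP1 \<alpha> \<beta> \<gamma> \<nu> = fst (jacobi_pineiro_I \<alpha> \<beta> \<gamma> \<nu>)"

definition JP2 :: "real \<Rightarrow> real \<Rightarrow> real \<Rightarrow> nat \<times> nat \<Rightarrow> real poly" where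
  "JP2 \<alpha> \<beta> \<gamma> \<nu> = snd (jacobi_pineiro_I \<alpha> \<beta> \<gamma> \<nu>)"

end

theory Submission
  imports Defs
begin

text \<open>
  Let \<open>N = \<bar>\<nu>\<bar>\<close> and let \<open>T\<close> be the set of the \<open>N\<close> exponents \<open>\<alpha> + i\<close>, \<open>\<beta> + i\<close> that occur in the
  linear form; they are distinct because \<open>\<alpha> - \<beta> \<notin> \<int>\<close>. Up to a factor that does not depend on \<open>k\<close>,
  the \<open>k\<close>-th moment of \<open>x\<^sup>t (1 - x)\<^sup>\<gamma>\<close> is the value at \<open>t\<close> of the polynomial
  \<open>R\<^sub>k(t) = (t + 1)\<^sub>k (t + \<gamma> + k + 2)\<^sub>N\<^sub>-\<^sub>1\<^sub>-\<^sub>k\<close> of degree \<open>N - 1\<close>. Among \<open>R\<^sub>0, \<dots>, R\<^sub>N\<^sub>-\<^sub>1\<close> only the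
  last does not vanish at \<open>p = - (\<gamma> + N)\<close>, so Lagrange interpolation on \<open>T\<close> evaluated at \<open>p\<close> solves
  the moment equations, and its weights are the claimed coefficients. The solution is unique because
  the \<open>R\<^sub>k\<close> span all polynomials of degree less than \<open>N\<close>.
\<close>

section \<open>Lagrange interpolation and Pochhammer symbols as polynomials\<close>

text \<open>The interpolant \<open>L\<close> has degree at most \<open>card T - 1\<close> and agrees
  with \<open>Q\<close> on \<open>T\<close>, so it is \<open>Q\<close>; the point \<open>p\<close>
  may then lie outside the nodes, which is how the identity gets used.\<close>

lemma lagrange_interpolation:
  fixes Q :: "'a::field poly"
  assumes "finite T" and "degree Q < card T"
  shows "(\<Sum>t\<in>T. poly Q t * (\<Prod>s\<in>T - {t}. (p - s) / (t - s))) = poly Q p"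
proof -
  define L where "L = (\<Sum>t\<in>T. smult (poly Q t) (\<Prod>s\<in>T - {t}. smult (1 / (t - s)) [:- s, 1:]))"
  have poly_L: "poly L x = (\<Sum>t\<in>T. poly Q t * (\<Prod>s\<in>T - {t}. (x - s) / (t - s)))" for x
    by (simp add: L_def poly_sum poly_prod diff_divide_distrib)
  have "degree L \<le> card T - 1"
    unfolding L_def
  proof (intro degree_sum_le assms(1))
    fix t assume t: "t \<in> T"
    have "degree (\<Prod>s\<in>T - {t}. smult (1 / (t - s)) [:- s, 1:])
        \<le> sum (degree \<circ> (\<lambda>s. smult (1 / (t - s)) [:- s, 1:])) (T - {t})"
      using assms(1) by (intro degree_prod_sum_le) auto
    also have "\<dots> \<le> (\<Sum>s\<in>T - {t}. 1)"
      by (intro sum_mono) auto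
    also have "\<dots> = card T - 1"
      using t assms(1) by simp
    finally show "degree (smult (poly Q t) (\<Prod>s\<in>T - {t}. smult (1 / (t - s)) [:- s, 1:])) \<le> card T - 1"
      using degree_smult_le le_trans by blast
  qed
  moreover have "poly L x = poly Q x" if "x \<in> T" for x
  proof -
    have "(\<Prod>s\<in>T - {t}. (x - s) / (t - s)) = 0" if "t \<in> T - {x}" for t
      using that \<open>x \<in> T\<close> assms(1) by (intro prod_zero) auto
    then have "(\<Sum>t\<in>T - {x}. poly Q t * (\<Prod>s\<in>T - {t}. (x - s) / (t - s))) = 0"
      by (intro sum.neutral) (simp del: prod_zero_iff)
    then have "poly L x = poly Q x * (\<Prod>s\<in>T - {x}. (x - s) / (x - s))"
      unfolding poly_L using that assms(1) by (subst sum.remove[of _ x]) (auto simp del: prod_zero_iff)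
    also have "(\<Prod>s\<in>T - {x}. (x - s) / (x - s)) = 1"
      by (intro prod.neutral) auto
    finally show ?thesis by simp
  qed
  ultimately have "L = Q"
    using assms(2) by (intro poly_eqI_degree[of T]) auto
  then show ?thesis
    using poly_L[of p] by simp
qed

lemma poly_pochhammer: "poly (pochhammer p k) x = pochhammer (poly p x) k"
  for p :: "'a::comm_ring_1 poly"
  by (simp add: pochhammer_prod poly_prod of_nat_poly)

lemma degree_pochhammer_linear_le: "degree (pochhammer [:a, 1:] k) \<le> k"
  for a :: "'a::comm_ring_1"
proof (induction k)
  case (Suc k)
  have "degree (pochhammer [:a, 1:] (Suc k))
      \<le> degree (pochhammer [:a, 1:] k) + degree ([:a, 1:] + of_nat k)"
    unfolding pochhammer_Suc by (rule degree_mult_le)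
  also have "\<dots> \<le> k + 1"
    using Suc by (intro add_mono) (auto simp: of_nat_poly)
  finally show ?case by simp
qed simp

lemma Gamma_pochhammer: "Gamma (z + real k) = pochhammer z k * Gamma z" if "z > 0"
proof -
  have "z \<notin> \<int>\<^sub>\<le>\<^sub>0" using that by (auto elim!: nonpos_Ints_cases)
  moreover from this have "Gamma z \<noteq> 0" by (simp add: Gamma_eq_zero_iff)
  ultimately show ?thesis by (simp add: pochhammer_Gamma)
qed

section \<open>The linear system of Beta moments: uniqueness and existence\<close>

text \<open>Both Gamma values that depend on \<open>k\<close> are moved to arguments free of
  \<open>k\<close>: \<open>Gamma (t + real k + 1)\<close> down to \<open>Gamma (t + 1)\<close>, and
  the denominator up to \<open>Gamma (t + \<gamma> + real N + 1)\<close>. The Pochhammer symbols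
  that arise form \<open>R\<^sub>k(t)\<close>.\<close>

lemma Beta_shift_eq:
  fixes t \<gamma> :: real
  assumes "t > -1" and "\<gamma> > -1" and "k < N"
  shows "Beta (t + real k + 1) (\<gamma> + 1) =
    Gamma (\<gamma> + 1) * Gamma (t + 1) / Gamma (t + \<gamma> + real N + 1) *
    (pochhammer (t + 1) k * pochhammer (t + \<gamma> + real k + 2) (N - 1 - k))"
proof -
  have *: "Gamma (t + \<gamma> + real k + 2) > 0"
    using assms by (intro Gamma_real_pos) auto
  have **: "Gamma (t + \<gamma> + real N + 1) > 0"
    using assms by (intro Gamma_real_pos) auto
  have "Gamma (t + real k + 1) = pochhammer (t + 1) k * Gamma (t + 1)"
    using Gamma_pochhammer[of "t + 1" k] assms by (simp add: add_ac)
  moreover have "t + \<gamma> + real N + 1 = (t + \<gamma> + real k + 2) + real (N - 1 - k)"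
    using assms by (simp add: of_nat_diff)
  then have "Gamma (t + \<gamma> + real N + 1) =
      pochhammer (t + \<gamma> + real k + 2) (N - 1 - k) * Gamma (t + \<gamma> + real k + 2)"
    using assms by (simp only:) (rule Gamma_pochhammer, simp)
  moreover have "t + real k + 1 + (\<gamma> + 1) = t + \<gamma> + real k + 2" by simp
  ultimately show ?thesis
    using * ** pochhammer_pos[of "t + \<gamma> + real k + 2" "N - 1 - k"] assms
    unfolding Beta_def by (simp add: field_simps)
qed

text \<open>This is the spanning property of the \<open>R\<^sub>k\<close>, in dual form. The
  induction shows that \<open>R\<^sub>0, \<dots>, R\<^sub>k\<close> generate all products of a
  polynomial of degree at most \<open>k\<close> with the second factor of \<open>R\<^sub>k\<close>;
  for \<open>k = N - 1\<close> that factor is 1.\<close>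

lemma moment_functional_eq_zero:
  fixes d :: "real \<Rightarrow> real"
  assumes "\<gamma> > -1"
    and d: "\<And>k. k < N \<Longrightarrow>
      (\<Sum>t\<in>T. d t * (pochhammer (t + 1) k * pochhammer (t + \<gamma> + real k + 2) (N - 1 - k))) = 0"
    and "degree S < N"
  shows "(\<Sum>t\<in>T. d t * poly S t) = 0"
proof -
  \<comment> \<open>For the step, a multiple of \<open>pochhammer (t + 1) (Suc k)\<close> matches \<open>S\<close> at \<open>- (\<gamma> + k + 2)\<close>;
     the linear factor split off from the difference extends the second Pochhammer symbol.\<close>
  have "(\<Sum>t\<in>T. d t * (poly S t * pochhammer (t + \<gamma> + real k + 2) (N - 1 - k))) = 0"
    if "k < N" "degree S \<le> k" for k S
    using that
  proof (induction k arbitrary: S)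
    case 0
    then obtain s where "S = [:s:]" by (auto elim: degree_eq_zeroE)
    then show ?case
      using d[of 0] 0 by (simp add: sum_distrib_left[symmetric] mult.left_commute[of _ s])
  next
    case (Suc k)
    define p where "p = - (\<gamma> + real k + 2)"
    define P :: "real poly" where "P = pochhammer [:1, 1:] (Suc k)"
    define c where "c = poly S p / poly P p"
    have "poly P p = pochhammer (- (\<gamma> + real (Suc k))) (Suc k)"
      by (simp add: P_def poly_pochhammer p_def algebra_simps)
    \<comment> \<open>The roots of \<open>P\<close> are the integers from -1 down to
      \<open>- Suc k\<close>, and \<open>p\<close> lies below all of them. Reflection makes this
      visible, since the new base \<open>\<gamma> + 1\<close> is positive.\<close>
    also have "\<dots> = (- 1) ^ Suc k * pochhammer (\<gamma> + 1) (Suc k)"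
      by (subst pochhammer_minus) simp
    also have "\<dots> \<noteq> 0"
      using pochhammer_pos[of "\<gamma> + 1" "Suc k"] assms(1) by simp
    finally have "poly P p \<noteq> 0" .
    then have "poly (S - smult c P) p = 0"
      by (simp add: c_def)
    then obtain S' where S': "S - smult c P = [:- p, 1:] * S'"
      unfolding poly_eq_0_iff_dvd dvd_def by auto
    have "degree P \<le> Suc k"
      unfolding P_def by (rule degree_pochhammer_linear_le)
    then have "degree (S - smult c P) \<le> Suc k"
      using Suc.prems by (intro degree_diff_le) (auto intro: order_trans[OF degree_smult_le])
    then have deg: "degree S' \<le> k"
      unfolding S' by (cases "S' = 0") (auto simp: degree_mult_eq simp del: mult_pCons_left)
    have S_eq: "poly S t = c * pochhammer (t + 1) (Suc k) + (t + \<gamma> + real k + 2) * poly S' t" for t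
    proof -
      have "S = smult c P + [:- p, 1:] * S'" using S' by (simp add: algebra_simps)
      then have "poly S t = poly (smult c P + [:- p, 1:] * S') t" by simp
      also have "\<dots> = c * poly P t + (t - p) * poly S' t" by (simp add: algebra_simps)
      also have "poly P t = pochhammer (t + 1) (Suc k)"
        by (simp add: P_def poly_pochhammer add.commute)
      finally show ?thesis by (simp add: p_def algebra_simps)
    qed
    have rec: "(t + \<gamma> + real k + 2) * pochhammer (t + \<gamma> + real (Suc k) + 2) (N - 1 - Suc k)
        = pochhammer (t + \<gamma> + real k + 2) (N - 1 - k)" for t
    proof -
      have "N - 1 - k = Suc (N - 1 - Suc k)" using Suc.prems by simp
      then show ?thesis by (simp only: pochhammer_rec) (simp add: add_ac)
    qed
    have "(\<Sum>t\<in>T. d t * (poly S t * pochhammer (t + \<gamma> + real (Suc k) + 2) (N - 1 - Suc k))) =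
       (\<Sum>t\<in>T. c * (d t * (pochhammer (t + 1) (Suc k) * pochhammer (t + \<gamma> + real (Suc k) + 2) (N - 1 - Suc k)))
         + d t * (poly S' t * pochhammer (t + \<gamma> + real k + 2) (N - 1 - k)))"
      unfolding S_eq by (intro sum.cong refl, subst rec[symmetric]) (simp add: algebra_simps)
    also have "\<dots> = 0"
      using d[of "Suc k"] Suc.IH[of S'] Suc.prems deg
      by (simp add: sum.distrib sum_distrib_left[symmetric])
    finally show ?case .
  qed
  from this[of "N - 1" S] assms(3) show ?thesis by simp
qed

text \<open>Testing the homogeneous system against the polynomial \<open>S\<close> that vanishes at
  every node except \<open>t\<close> isolates \<open>c t\<close>, multiplied by the nonzero numbers
  \<open>w t\<close> and \<open>poly S t\<close>.\<close>

lemma Beta_system_unique: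
  fixes c :: "real \<Rightarrow> real"
  assumes "finite T" and T: "\<And>t. t \<in> T \<Longrightarrow> t > -1" and "\<gamma> > -1"
    and c: "\<And>k. k < card T \<Longrightarrow> (\<Sum>t\<in>T. c t * Beta (t + real k + 1) (\<gamma> + 1)) = 0"
    and "t \<in> T"
  shows "c t = 0"
proof -
  define N where "N = card T"
  define w where "w t = Gamma (\<gamma> + 1) * Gamma (t + 1) / Gamma (t + \<gamma> + real N + 1)" for t
  have "N > 0"
    using assms by (auto simp: N_def card_gt_0_iff)
  define S :: "real poly" where "S = (\<Prod>s\<in>T - {t}. [:- s, 1:])"
  have "degree S = card (T - {t})"
    unfolding S_def by (subst degree_prod_sum_eq) auto
  then have "degree S < N"
    using \<open>N > 0\<close> assms by (simp add: N_def)
  moreover have "(\<Sum>t\<in>T. c t * w t *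
      (pochhammer (t + 1) k * pochhammer (t + \<gamma> + real k + 2) (N - 1 - k))) = 0" if "k < N" for k
    using c[of k] that assms(3) T
    by (simp add: Beta_shift_eq[where N = N] w_def N_def mult_ac cong: sum.cong)
  ultimately have "(\<Sum>s\<in>T. c s * w s * poly S s) = 0"
    using assms(3) by (intro moment_functional_eq_zero[where d = "\<lambda>t. c t * w t"]) auto
  also have "(\<Sum>s\<in>T. c s * w s * poly S s) = c t * w t * poly S t + (\<Sum>s\<in>T - {t}. c s * w s * poly S s)"
    using assms by (intro sum.remove) auto
  also have "(\<Sum>s\<in>T - {t}. c s * w s * poly S s) = 0"
    using assms(1) by (intro sum.neutral) (auto simp: S_def poly_prod)
  finally have "c t * w t * poly S t = 0" by simp
  moreover have "poly S t \<noteq> 0"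
    using assms(1) by (auto simp: S_def poly_prod)
  moreover have "w t > 0"
    using T[OF assms(5)] assms(3) \<open>N > 0\<close>
    by (auto simp: w_def intro!: divide_pos_pos mult_pos_pos)
  ultimately show ?thesis by simp
qed

text \<open>
  Up to a constant, the Lagrange basis polynomial of the node \<open>t\<close> at \<open>- (\<gamma> + card T)\<close> divided by
  the part of the Beta function that does not depend on \<open>k\<close> in \<open>Beta_shift_eq\<close>.
\<close>

definition beta_weight :: "real \<Rightarrow> real set \<Rightarrow> real \<Rightarrow> real" where
  "beta_weight \<gamma> T t =
     Gamma (t + \<gamma> + real (card T) + 1) / (Gamma (\<gamma> + real (card T)) * Gamma (t + 1)) *
     (\<Prod>s\<in>T - {t}. (\<gamma> + real (card T) + s) / (t - s))"

text \<open>After the Beta values are factored, the sum is a constant times the Lagrange interpolant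
  of \<open>Q = R\<^sub>k\<close> at \<open>p\<close>, that is, a constant times
  \<open>poly Q p\<close>. The factor \<open>Gamma (\<gamma> + real (card T))\<close> in the weight
  normalises the last moment to 1.\<close>

lemma Beta_system_solution:
  assumes "finite T" and T: "\<And>t. t \<in> T \<Longrightarrow> t > -1" and "\<gamma> > -1" and "k < card T"
  shows "(\<Sum>t\<in>T. beta_weight \<gamma> T t * Beta (t + real k + 1) (\<gamma> + 1))
           = (if k + 1 = card T then 1 else 0)"
proof -
  define N where "N = card T"
  define p where "p = - (\<gamma> + real N)"
  define Q where "Q = pochhammer [:1, 1:] k * pochhammer [:\<gamma> + real k + 2, 1:] (N - 1 - k)"
  have poly_Q: "poly Q t = pochhammer (t + 1) k * pochhammer (t + \<gamma> + real k + 2) (N - 1 - k)" for t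
    by (simp add: Q_def poly_pochhammer add_ac)
  have "degree Q \<le> k + (N - 1 - k)"
    unfolding Q_def by (intro order_trans[OF degree_mult_le] add_mono degree_pochhammer_linear_le)
  then have deg: "degree Q < card T" using assms by (simp add: N_def)
  have *: "beta_weight \<gamma> T t * Beta (t + real k + 1) (\<gamma> + 1) =
      (-1) ^ (N - 1) * Gamma (\<gamma> + 1) / Gamma (\<gamma> + real N) *
      (poly Q t * (\<Prod>s\<in>T - {t}. (p - s) / (t - s)))" if t: "t \<in> T" for t
  proof -
    \<comment> \<open>By the choice of \<open>p\<close>, each of the \<open>N - 1\<close> numerators
      is \<open>- (p - s)\<close>.\<close>
    have "(\<Prod>s\<in>T - {t}. (\<gamma> + real N + s) / (t - s)) =
        (\<Prod>s\<in>T - {t}. (-1) * ((p - s) / (t - s)))"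
      by (intro prod.cong) (auto simp: p_def field_simps)
    also have "\<dots> = (-1) ^ (N - 1) * (\<Prod>s\<in>T - {t}. (p - s) / (t - s))"
      using t assms(1) by (simp only: prod.distrib) (simp add: N_def)
    finally have 1: "(\<Prod>s\<in>T - {t}. (\<gamma> + real N + s) / (t - s)) =
      (-1) ^ (N - 1) * (\<Prod>s\<in>T - {t}. (p - s) / (t - s))" .
    have "Gamma (t + \<gamma> + real N + 1) > 0" "Gamma (t + 1) > 0" "Gamma (\<gamma> + real N) > 0"
      using T[OF t] assms(3,4) by (auto intro!: Gamma_real_pos simp: N_def)
    then show ?thesis
      using Beta_shift_eq[OF T[OF t] assms(3,4)]
      unfolding beta_weight_def poly_Q N_def[symmetric] 1 by (simp add: field_simps)
  qed
  have "(\<Sum>t\<in>T. beta_weight \<gamma> T t * Beta (t + real k + 1) (\<gamma> + 1)) =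
      (-1) ^ (N - 1) * Gamma (\<gamma> + 1) / Gamma (\<gamma> + real N) * poly Q p"
    by (subst lagrange_interpolation[OF assms(1) deg, of p, symmetric])
      (simp only: * sum_distrib_left cong: sum.cong)
  also have "\<dots> = (if k + 1 = N then 1 else 0)"
  proof (cases "k + 1 = N")
    case True
    \<comment> \<open>For \<open>k = N - 1\<close> the second factor of \<open>Q\<close> is empty.
      Reflecting the first produces a sign that cancels the one from the Lagrange products.\<close>
    have "poly Q p = pochhammer (- (\<gamma> + real k)) k"
      using True by (simp add: poly_Q p_def algebra_simps flip: True)
    also have "\<dots> = (-1) ^ k * pochhammer (\<gamma> + 1) k"
      by (subst pochhammer_minus) simp
    finally have poly_Q_p: "poly Q p = (-1) ^ k * pochhammer (\<gamma> + 1) k" .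
    have "pochhammer (\<gamma> + 1) k * Gamma (\<gamma> + 1) = Gamma (\<gamma> + real N)"
      using Gamma_pochhammer[of "\<gamma> + 1" k] assms(3) by (simp add: add_ac flip: True)
    moreover have "Gamma (\<gamma> + real N) > 0"
      using assms(3) by (intro Gamma_real_pos) (simp flip: True)
    moreover have "(-1) ^ k * (-1) ^ k = (1::real)"
      by (simp flip: power_mult_distrib)
    ultimately have *: "((-1) ^ k * (-1) ^ k) * (pochhammer (\<gamma> + 1) k * Gamma (\<gamma> + 1)) / Gamma (\<gamma> + real N) = (1::real)"
      by (simp only:) simp
    have "(-1) ^ (N - 1) * Gamma (\<gamma> + 1) / Gamma (\<gamma> + real N) * poly Q p =
        ((-1) ^ k * (-1) ^ k) * (pochhammer (\<gamma> + 1) k * Gamma (\<gamma> + 1)) / Gamma (\<gamma> + real N)"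
      by (simp add: poly_Q_p flip: True)
    then show ?thesis unfolding * if_P[OF True] .
  next
    case False
    \<comment> \<open>The second Pochhammer symbol starts at the integer
      \<open>k + 2 - N \<le> 0\<close>, so its factor with index \<open>N - 2 - k\<close> is
      zero.\<close>
    then have "poly Q p = 0"
      using assms(4) by (auto simp: poly_Q p_def N_def pochhammer_eq_0_iff of_nat_diff algebra_simps
          intro!: exI[of _ "card T - 2 - k"])
    then show ?thesis using False by simp
  qed
  finally show ?thesis by (simp add: N_def)
qed

section \<open>From orthogonality integrals to linear equations\<close>

lemma deg_constraint_iff: "deg_constraint n A \<longleftrightarrow> (\<forall>i\<ge>n. coeff A i = 0)"
proof (cases n)
  case (Suc k)
  then show ?thesis
    by (auto simp: deg_constraint_def coeff_eq_0 Suc_le_eq intro: degree_le)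
qed (auto simp: deg_constraint_def poly_eq_iff)

lemma has_integral_poly_Beta:
  assumes "a > -1" and "\<gamma> > -1" and A: "\<forall>i\<ge>n. coeff A i = 0"
  shows "((\<lambda>x. poly A x * x powr a * (1 - x) powr \<gamma> * x ^ k) has_integral
           (\<Sum>i<n. coeff A i * Beta (a + real i + real k + 1) (\<gamma> + 1))) {0..1}"
proof -
  have poly_A: "poly A x = (\<Sum>i<n. coeff A i * x ^ i)" for x
  proof -
    \<comment> \<open>Neither range need contain the other: \<open>n\<close> can exceed
      \<open>degree A\<close>, while for \<open>n = 0\<close> the sum up to \<open>degree A\<close>
      still has a term. Both are compared inside a common range.\<close>
    have "poly A x = (\<Sum>i\<le>max n (degree A). coeff A i * x ^ i)"
      unfolding poly_altdef by (intro sum.mono_neutral_left) (auto simp: coeff_eq_0)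
    also have "\<dots> = (\<Sum>i<n. coeff A i * x ^ i)"
      using A by (intro sum.mono_neutral_right) auto
    finally show ?thesis .
  qed
  have "((\<lambda>x. \<Sum>i<n. coeff A i * (x powr (a + real i + real k + 1 - 1) * (1 - x) powr (\<gamma> + 1 - 1))) has_integral
           (\<Sum>i<n. coeff A i * Beta (a + real i + real k + 1) (\<gamma> + 1))) {0..1}"
    using assms by (intro has_integral_sum has_integral_mult_right has_integral_Beta_real) auto
  then show ?thesis
  proof (rule has_integral_eq[rotated])
    fix x :: real assume x: "x \<in> {0..1}"
    \<comment> \<open>At \<open>x = 0\<close> both sides vanish because \<open>0 powr a = 0\<close>,
      so the integrands agree on the closed interval.\<close>
    have *: "x powr (a + real i + real k) = x powr a * x ^ i * x ^ k" for i
      using x by (cases "x = 0") (auto simp: powr_add powr_realpow)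
    show "(\<Sum>i<n. coeff A i * (x powr (a + real i + real k + 1 - 1) * (1 - x) powr (\<gamma> + 1 - 1))) =
        poly A x * x powr a * (1 - x) powr \<gamma> * x ^ k"
      by (simp add: poly_A * sum_distrib_left sum_distrib_right mult_ac)
  qed
qed

text \<open>The integral of the linear form exists with an explicit value, so uniqueness of
  integrals turns each condition into an equation between Beta sums. No integrals are needed
  afterwards.\<close>

lemma is_jacobi_pineiro_I_iff:
  assumes "\<alpha> > -1" and "\<beta> > -1" and "\<gamma> > -1"
  shows "is_jacobi_pineiro_I \<alpha> \<beta> \<gamma> (n, m) (A, B) \<longleftrightarrow>
    (\<forall>i\<ge>n. coeff A i = 0) \<and> (\<forall>i\<ge>m. coeff B i = 0) \<and>
    (\<forall>k<n + m. (\<Sum>i<n. coeff A i * Beta (\<alpha> + real i + real k + 1) (\<gamma> + 1))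
        + (\<Sum>i<m. coeff B i * Beta (\<beta> + real i + real k + 1) (\<gamma> + 1))
      = (if k + 1 = n + m then 1 else 0))"
proof -
  define f where "f k x = (poly A x * x powr \<alpha> + poly B x * x powr \<beta>) * (1 - x) powr \<gamma> * x ^ k"
    for k :: nat and x
  define I where "I k = (\<Sum>i<n. coeff A i * Beta (\<alpha> + real i + real k + 1) (\<gamma> + 1))
        + (\<Sum>i<m. coeff B i * Beta (\<beta> + real i + real k + 1) (\<gamma> + 1))" for k :: nat
  have "(f k has_integral J) {0..1} \<longleftrightarrow> I k = J"
    if "\<forall>i\<ge>n. coeff A i = 0" "\<forall>i\<ge>m. coeff B i = 0" for k J
  proof -
    have "(f k has_integral I k) {0..1}"
      using has_integral_add[OF has_integral_poly_Beta[OF assms(1,3) that(1), of k]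
          has_integral_poly_Beta[OF assms(2,3) that(2), of k]]
      unfolding f_def I_def by (simp add: algebra_simps)
    then show ?thesis
      using has_integral_unique by blast
  qed
  moreover have "(\<forall>k. k + 2 \<le> n + m \<longrightarrow> I k = 0) \<and> (\<forall>k. k + 1 = n + m \<longrightarrow> I k = 1) \<longleftrightarrow>
      (\<forall>k<n + m. I k = (if k + 1 = n + m then 1 else 0))"
    by (auto simp: Suc_le_eq less_Suc_eq)
  ultimately show ?thesis
    unfolding is_jacobi_pineiro_I_def f_def[symmetric] I_def[symmetric] Let_def fst_conv snd_conv
      deg_constraint_iff by blast
qed

section \<open>The nodes and the closed form of their weights\<close>

definition jp_nodes :: "real \<Rightarrow> real \<Rightarrow> nat \<Rightarrow> nat \<Rightarrow> real set" where
  "jp_nodes \<alpha> \<beta> n m = (\<lambda>i. \<alpha> + real i) ` {..<n} \<union> (\<lambda>i. \<beta> + real i) ` {..<m}"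

lemma jp_nodes_commute: "jp_nodes \<alpha> \<beta> n m = jp_nodes \<beta> \<alpha> m n"
  by (simp add: jp_nodes_def Un_commute)

lemma finite_jp_nodes [simp]: "finite (jp_nodes \<alpha> \<beta> n m)"
  by (simp add: jp_nodes_def)

lemma shifts_distinct:
  fixes \<alpha> \<beta> :: real
  assumes "\<alpha> - \<beta> \<notin> \<int>"
  shows "\<alpha> + real i \<noteq> \<beta> + real j"
proof
  assume "\<alpha> + real i = \<beta> + real j"
  then have "\<alpha> - \<beta> = of_int (int j - int i)" by simp
  then show False using assms by (metis Ints_of_int)
qed

lemma sum_jp_nodes:
  assumes "\<alpha> - \<beta> \<notin> \<int>"
  shows "(\<Sum>t\<in>jp_nodes \<alpha> \<beta> n m. f t) = (\<Sum>i<n. f (\<alpha> + real i)) + (\<Sum>i<m. f (\<beta> + real i))"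
  unfolding jp_nodes_def using shifts_distinct[OF assms]
  by (subst sum.union_disjoint) (auto simp: sum.reindex inj_on_def)

lemma card_jp_nodes:
  assumes "\<alpha> - \<beta> \<notin> \<int>"
  shows "card (jp_nodes \<alpha> \<beta> n m) = n + m"
  using sum_jp_nodes[OF assms, of "\<lambda>_. 1::nat" n m] by simp

lemma prod_jp_nodes_remove:
  assumes "\<alpha> - \<beta> \<notin> \<int>" and "i < n"
  shows "(\<Prod>t\<in>jp_nodes \<alpha> \<beta> n m - {\<alpha> + real i}. f t) =
    (\<Prod>j\<in>{..<n} - {i}. f (\<alpha> + real j)) * (\<Prod>j<m. f (\<beta> + real j))"
proof -
  have "jp_nodes \<alpha> \<beta> n m - {\<alpha> + real i} =
      (\<lambda>j. \<alpha> + real j) ` ({..<n} - {i}) \<union> (\<lambda>j. \<beta> + real j) ` {..<m}"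
    using shifts_distinct[OF assms(1), of i] by (fastforce simp: jp_nodes_def)
  then show ?thesis
    using shifts_distinct[OF assms(1)]
    by (simp only:, subst prod.union_disjoint) (auto simp: prod.reindex inj_on_def)
qed

text \<open>Omitting one index leaves two runs of consecutive indices, each of which becomes a
  factorial or a Pochhammer symbol in the weights.\<close>

lemma prod_lessThan_remove:
  fixes f :: "nat \<Rightarrow> 'a::comm_monoid_mult"
  assumes "i < n"
  shows "(\<Prod>j\<in>{..<n} - {i}. f j) = (\<Prod>j<i. f j) * (\<Prod>j<n - 1 - i. f (Suc i + j))"
proof -
  have "{..<n} - {i} = {..<i} \<union> {Suc i..<n}"
    using assms by auto
  then have "(\<Prod>j\<in>{..<n} - {i}. f j) = (\<Prod>j<i. f j) * (\<Prod>j=Suc i..<n. f j)"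
    using prod.union_disjoint[of "{..<i}" "{Suc i..<n}" f] by (auto simp: disjoint_iff)
  also have "(\<Prod>j=Suc i..<n. f j) = (\<Prod>j<n - 1 - i. f (Suc i + j))"
    using assms by (intro prod.reindex_bij_witness[of _ "\<lambda>j. Suc i + j" "\<lambda>j. j - Suc i"]) auto
  finally show ?thesis .
qed

text \<open>Stated for an arbitrary multi-index, so that all three formulas are special cases; the
  second component arises by exchanging \<open>\<alpha>\<close> with \<open>\<beta>\<close> and
  \<open>n\<close> with \<open>m\<close>. The index \<open>i\<close> is the power of
  \<open>x\<close>.\<close>

definition jp_coeff :: "real \<Rightarrow> real \<Rightarrow> real \<Rightarrow> nat \<Rightarrow> nat \<Rightarrow> nat \<Rightarrow> real" where
  "jp_coeff \<alpha> \<beta> \<gamma> n m i =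
     Gamma (2 * real n + real m + \<alpha> + \<gamma>) * pochhammer (real n + real m + \<beta> + \<gamma>) m
       / (fact (n - 1) * Gamma (real n + real m + \<gamma>)) *
     ((-1) ^ (n - 1 - i) * real ((n - 1) choose i) *
       (pochhammer (real n + real m + \<alpha> + \<gamma>) i
         / (Gamma (\<alpha> + real i + 1) * pochhammer (\<alpha> - \<beta> + real i - real m + 1) m)))"

text \<open>Differences within the family of \<open>\<alpha>\<close> give a signed product of
  factorials, hence the binomial coefficient; differences to the family of \<open>\<beta>\<close>
  give the Pochhammer symbol in the denominator.\<close>

lemma beta_weight_jp_nodes:
  assumes "\<alpha> > -1" and "\<gamma> > -1" and "\<alpha> - \<beta> \<notin> \<int>" and "i < n"
  shows "beta_weight \<gamma> (jp_nodes \<alpha> \<beta> n m) (\<alpha> + real i) = jp_coeff \<alpha> \<beta> \<gamma> n m i"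
proof -
  define z where "z = real n + real m + \<alpha> + \<gamma>"
  have "(\<Prod>j<i. real i - real j) = (\<Prod>j<i. real (Suc j))"
    by (subst prod.nat_diff_reindex[symmetric]) (intro prod.cong, auto)
  then have fact1: "(\<Prod>j<i. real i - real j) = fact i"
    by (simp add: fact_prod_Suc atLeast0LessThan)
  have "(\<Prod>j<n - 1 - i. real i - real (Suc i + j)) = (\<Prod>j<n - 1 - i. (-1) * real (Suc j))"
    by (intro prod.cong) auto
  then have fact2: "(\<Prod>j<n - 1 - i. real i - real (Suc i + j)) = (-1) ^ (n - 1 - i) * fact (n - 1 - i)"
    by (simp only: prod.distrib) (simp add: fact_prod_Suc atLeast0LessThan)
  have den1: "(\<Prod>j\<in>{..<n} - {i}. \<alpha> + real i - (\<alpha> + real j)) =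
      (-1) ^ (n - 1 - i) * fact i * fact (n - 1 - i)"
    using fact1 fact2 by (simp add: prod_lessThan_remove[OF assms(4)])
  \<comment> \<open>The omitted node corresponds to the missing factor \<open>z + real i\<close>.
    The run above it is absorbed by \<open>Gamma (z + real i + 1)\<close> in \<open>Gamma_z\<close>,
    which makes that Gamma factor independent of \<open>i\<close>.\<close>
  have num1: "(\<Prod>j\<in>{..<n} - {i}. \<gamma> + real (n + m) + (\<alpha> + real j)) =
      pochhammer z i * pochhammer (z + real i + 1) (n - 1 - i)"
    by (simp add: prod_lessThan_remove[OF assms(4)] pochhammer_prod atLeast0LessThan z_def add_ac)
  \<comment> \<open>The factors descend in \<open>j\<close>; read backwards they form a rising
    factorial.\<close>
  have den2: "(\<Prod>j<m. \<alpha> + real i - (\<beta> + real j)) = pochhammer (\<alpha> - \<beta> + real i - real m + 1) m"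
    unfolding pochhammer_prod atLeast0LessThan
    by (subst prod.nat_diff_reindex[symmetric]) (intro prod.cong, auto simp: of_nat_diff)
  have num2: "(\<Prod>j<m. \<gamma> + real (n + m) + (\<beta> + real j)) = pochhammer (real n + real m + \<beta> + \<gamma>) m"
    by (simp add: pochhammer_prod atLeast0LessThan add_ac)
  have "z + real i + 1 > 0"
    using assms by (simp add: z_def)
  then have Gamma_z: "Gamma (2 * real n + real m + \<alpha> + \<gamma>) =
      pochhammer (z + real i + 1) (n - 1 - i) * Gamma (z + real i + 1)"
    using Gamma_pochhammer[of "z + real i + 1" "n - 1 - i"] assms(4)
    by (simp add: z_def of_nat_diff algebra_simps)
  have choose: "real ((n - 1) choose i) = fact (n - 1) / (fact i * fact (n - 1 - i))"
    using assms(4) by (simp add: binomial_fact)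
  have sign: "a / ((-1) ^ k * b) = (-1) ^ k * a / b" for a b :: real and k :: nat
    by (cases "even k") auto
  have "beta_weight \<gamma> (jp_nodes \<alpha> \<beta> n m) (\<alpha> + real i) =
      Gamma (z + real i + 1) / (Gamma (real n + real m + \<gamma>) * Gamma (\<alpha> + real i + 1)) *
      (pochhammer z i * pochhammer (z + real i + 1) (n - 1 - i) / ((-1) ^ (n - 1 - i) * (fact i * fact (n - 1 - i))) *
       (pochhammer (real n + real m + \<beta> + \<gamma>) m / pochhammer (\<alpha> - \<beta> + real i - real m + 1) m))"
    unfolding beta_weight_def card_jp_nodes[OF assms(3)] prod_jp_nodes_remove[OF assms(3,4)]
      prod_dividef den1 den2 num1 num2
    by (simp add: z_def add_ac mult.assoc)
  also have "\<dots> = jp_coeff \<alpha> \<beta> \<gamma> n m i"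
    unfolding jp_coeff_def Gamma_z choose sign by (simp add: z_def mult_ac)
  finally show ?thesis .
qed

section \<open>The explicit polynomials for a general multi-index\<close>

definition jp_poly :: "real \<Rightarrow> real \<Rightarrow> real \<Rightarrow> nat \<Rightarrow> nat \<Rightarrow> real poly" where
  "jp_poly \<alpha> \<beta> \<gamma> n m = (\<Sum>i<n. monom (jp_coeff \<alpha> \<beta> \<gamma> n m i) i)"

lemma coeff_jp_poly: "coeff (jp_poly \<alpha> \<beta> \<gamma> n m) i = (if i < n then jp_coeff \<alpha> \<beta> \<gamma> n m i else 0)"
  by (simp add: jp_poly_def coeff_sum)

text \<open>Existence and uniqueness are both required to evaluate the definite description; they
  come from the two results on the Beta system, with polynomial coefficients read as weights on the
  nodes.\<close>

lemma jacobi_pineiro_I_eq: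
  assumes "\<alpha> > -1" and "\<beta> > -1" and "\<gamma> > -1" and "\<alpha> - \<beta> \<notin> \<int>"
  shows "jacobi_pineiro_I \<alpha> \<beta> \<gamma> (n, m) = (jp_poly \<alpha> \<beta> \<gamma> n m, jp_poly \<beta> \<alpha> \<gamma> m n)"
proof -
  define T where "T = jp_nodes \<alpha> \<beta> n m"
  have "\<beta> - \<alpha> \<notin> \<int>"
    using assms(4) Ints_minus[of "\<beta> - \<alpha>"] by auto
  then have wt: "beta_weight \<gamma> T (\<alpha> + real i) = jp_coeff \<alpha> \<beta> \<gamma> n m i" if "i < n" for i
    using that assms by (simp add: T_def beta_weight_jp_nodes)
  have wt': "beta_weight \<gamma> T (\<beta> + real i) = jp_coeff \<beta> \<alpha> \<gamma> m n i" if "i < m" for i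
    using that assms \<open>\<beta> - \<alpha> \<notin> \<int>\<close>
    by (simp add: T_def jp_nodes_commute[of \<alpha> \<beta>] beta_weight_jp_nodes)
  have T: "finite T" "card T = n + m" "\<And>t. t \<in> T \<Longrightarrow> t > -1"
    using assms by (auto simp: T_def card_jp_nodes) (auto simp: jp_nodes_def)
  have sum_T: "(\<Sum>t\<in>T. f t) = (\<Sum>i<n. f (\<alpha> + real i)) + (\<Sum>i<m. f (\<beta> + real i))" for f :: "real \<Rightarrow> real"
    by (simp add: T_def sum_jp_nodes assms)
  note solution = Beta_system_solution[OF T(1,3) assms(3), unfolded T(2) sum_T]
  have is_sol: "is_jacobi_pineiro_I \<alpha> \<beta> \<gamma> (n, m) (jp_poly \<alpha> \<beta> \<gamma> n m, jp_poly \<beta> \<alpha> \<gamma> m n)"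
    unfolding is_jacobi_pineiro_I_iff[OF assms(1-3)]
    using solution by (simp add: coeff_jp_poly wt wt')
  have eqn: "(\<Sum>i<n. coeff A i * Beta (\<alpha> + real i + real k + 1) (\<gamma> + 1))
        + (\<Sum>i<m. coeff B i * Beta (\<beta> + real i + real k + 1) (\<gamma> + 1))
      = (if k + 1 = n + m then 1 else 0)"
    if "is_jacobi_pineiro_I \<alpha> \<beta> \<gamma> (n, m) (A, B)" "k < n + m" for A B k
    using that unfolding is_jacobi_pineiro_I_iff[OF assms(1-3)] by blast
  have uniq: "(A, B) = (jp_poly \<alpha> \<beta> \<gamma> n m, jp_poly \<beta> \<alpha> \<gamma> m n)"
    if AB: "is_jacobi_pineiro_I \<alpha> \<beta> \<gamma> (n, m) (A, B)" for A B
  proof -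
    define A' where "A' = A - jp_poly \<alpha> \<beta> \<gamma> n m"
    define B' where "B' = B - jp_poly \<beta> \<alpha> \<gamma> m n"
    \<comment> \<open>The coefficients of both differences become one function on the nodes. The
      floor recovers the index, and the choice of branch is unambiguous because the two families are
      disjoint.\<close>
    define c where "c t = (if \<exists>i. t = \<alpha> + real i then coeff A' (nat \<lfloor>t - \<alpha>\<rfloor>) else coeff B' (nat \<lfloor>t - \<beta>\<rfloor>))" for t
    have c1: "c (\<alpha> + real i) = coeff A' i" for i
      by (auto simp: c_def)
    have c2: "c (\<beta> + real i) = coeff B' i" for i
      using shifts_distinct[OF \<open>\<beta> - \<alpha> \<notin> \<int>\<close>, of i] by (auto simp: c_def)
    have c0: "c t = 0" if "t \<in> T" for t
    proof (rule Beta_system_unique[OF T(1,3) assms(3) _ that])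
      fix k assume "k < card T"
      then have k: "k < n + m" by (simp add: T(2))
      have "(\<Sum>i<n. coeff A i * Beta (\<alpha> + real i + real k + 1) (\<gamma> + 1))
            + (\<Sum>i<m. coeff B i * Beta (\<beta> + real i + real k + 1) (\<gamma> + 1))
          = (\<Sum>i<n. coeff (jp_poly \<alpha> \<beta> \<gamma> n m) i * Beta (\<alpha> + real i + real k + 1) (\<gamma> + 1))
            + (\<Sum>i<m. coeff (jp_poly \<beta> \<alpha> \<gamma> m n) i * Beta (\<beta> + real i + real k + 1) (\<gamma> + 1))"
        by (rule trans[OF eqn[OF AB k] eqn[OF is_sol k, symmetric]])
      then show "(\<Sum>t\<in>T. c t * Beta (t + real k + 1) (\<gamma> + 1)) = 0"
        unfolding sum_T c1 c2 A'_def B'_def coeff_diff left_diff_distrib sum_subtractf by linarith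
    qed
    have "coeff A' i = 0" for i
    proof (cases "i < n")
      case True
      then show ?thesis
        using c0[of "\<alpha> + real i"] by (simp add: c1 T_def jp_nodes_def)
    next
      case False
      then show ?thesis
        using AB is_sol unfolding is_jacobi_pineiro_I_iff[OF assms(1-3)] A'_def coeff_diff
        by (metis diff_self not_less)
    qed
    moreover have "coeff B' i = 0" for i
    proof (cases "i < m")
      case True
      then show ?thesis
        using c0[of "\<beta> + real i"] by (simp add: c2 T_def jp_nodes_def)
    next
      case False
      then show ?thesis
        using AB is_sol unfolding is_jacobi_pineiro_I_iff[OF assms(1-3)] B'_def coeff_diff
        by (metis diff_self not_less)
    qed
    ultimately have "A' = 0" "B' = 0"
      by (simp_all add: poly_eq_iff)
    then show ?thesis by (simp add: A'_def B'_def)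
  qed
  show ?thesis
    unfolding jacobi_pineiro_I_def by (rule the_equality, rule is_sol) (metis uniq surj_pair)
qed

text \<open>The substitution \<open>i = n - 1 - j\<close> lists the powers in descending order. For
  \<open>n = 0\<close> the range \<open>{0..n - 1}\<close> would still contain \<open>j = 0\<close>,
  whence the assumption.\<close>

lemma poly_jp_poly:
  assumes "n \<ge> 1"
  shows "poly (jp_poly \<alpha> \<beta> \<gamma> n m) x =
    Gamma (2 * real n + real m + \<alpha> + \<gamma>) * pochhammer (real n + real m + \<beta> + \<gamma>) m
      / (fact (n - 1) * Gamma (real n + real m + \<gamma>))
    * (\<Sum>j = 0..n - 1. (-1) ^ j * real ((n - 1) choose j)
         * (pochhammer (real n + real m + \<alpha> + \<gamma>) (n - 1 - j)
             / (Gamma (\<alpha> + real n - real j) * pochhammer (\<alpha> - \<beta> + real n - real m - real j) m))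
         * x ^ (n - 1 - j))"
proof -
  have "poly (jp_poly \<alpha> \<beta> \<gamma> n m) x = (\<Sum>i<n. jp_coeff \<alpha> \<beta> \<gamma> n m i * x ^ i)"
    by (simp add: jp_poly_def poly_sum poly_monom)
  also have "\<dots> = (\<Sum>j = 0..n - 1. jp_coeff \<alpha> \<beta> \<gamma> n m (n - 1 - j) * x ^ (n - 1 - j))"
    using assms by (intro sum.reindex_bij_witness[of _ "\<lambda>j. n - 1 - j" "\<lambda>j. n - 1 - j"]) auto
  also have "\<dots> = (\<Sum>j = 0..n - 1.
    Gamma (2 * real n + real m + \<alpha> + \<gamma>) * pochhammer (real n + real m + \<beta> + \<gamma>) m
      / (fact (n - 1) * Gamma (real n + real m + \<gamma>))
    * ((-1) ^ j * real ((n - 1) choose j)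
         * (pochhammer (real n + real m + \<alpha> + \<gamma>) (n - 1 - j)
             / (Gamma (\<alpha> + real n - real j) * pochhammer (\<alpha> - \<beta> + real n - real m - real j) m))
         * x ^ (n - 1 - j)))"
  proof (intro sum.cong refl)
    fix j assume j: "j \<in> {0..n - 1}"
    then have 1: "\<alpha> + real (n - 1 - j) + 1 = \<alpha> + real n - real j"
      and 2: "\<alpha> - \<beta> + real (n - 1 - j) - real m + 1 = \<alpha> - \<beta> + real n - real m - real j"
      and 3: "n - 1 - (n - 1 - j) = j" and 4: "(n - 1) choose (n - 1 - j) = (n - 1) choose j"
      using assms binomial_symmetric[of j "n - 1"] by (auto simp: of_nat_diff)
    show "jp_coeff \<alpha> \<beta> \<gamma> n m (n - 1 - j) * x ^ (n - 1 - j) =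
      Gamma (2 * real n + real m + \<alpha> + \<gamma>) * pochhammer (real n + real m + \<beta> + \<gamma>) m
        / (fact (n - 1) * Gamma (real n + real m + \<gamma>))
      * ((-1) ^ j * real ((n - 1) choose j)
           * (pochhammer (real n + real m + \<alpha> + \<gamma>) (n - 1 - j)
               / (Gamma (\<alpha> + real n - real j) * pochhammer (\<alpha> - \<beta> + real n - real m - real j) m))
           * x ^ (n - 1 - j))"
      unfolding jp_coeff_def 1 2 3 4 by (simp only: mult.assoc)
  qed
  finally show ?thesis by (simp only: sum_distrib_left)
qed

section \<open>Specialisation to the step-line\<close>

theorem theorem9:
  fixes \<alpha> \<beta> \<gamma> :: real
  assumes "\<alpha> > -1" and "\<beta> > -1" and "\<gamma> > -1" and "\<alpha> - \<beta> \<notin> \<int>"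
  shows
    "(\<forall>n::nat. n \<ge> 1 \<longrightarrow>
        JP1 \<alpha> \<beta> \<gamma> (n, n) = JP2 \<beta> \<alpha> \<gamma> (n, n) \<and>
        (\<forall>x::real. poly (JP1 \<alpha> \<beta> \<gamma> (n, n)) x =
           pochhammer (2 * real n + \<alpha> + \<gamma>) n * pochhammer (2 * real n + \<beta> + \<gamma>) n
             / (fact (n - 1) * Gamma (2 * real n + \<gamma>))
           * (\<Sum>j = 0..n - 1. (-1) ^ j * real ((n - 1) choose j)
                * (Gamma (3 * real n - (real j + 1) + \<alpha> + \<gamma>)
                   / (Gamma (real n - real j + \<alpha>) * pochhammer (\<alpha> - \<beta> - real j) n))
                * x ^ (n - 1 - j))))
     \<and> (\<forall>n::nat. \<forall>x::real. poly (JP1 \<alpha> \<beta> \<gamma> (n + 1, n)) x =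
           Gamma (3 * real n + 2 + \<alpha> + \<gamma>) * pochhammer (2 * real n + 1 + \<beta> + \<gamma>) n
             / (fact n * Gamma (2 * real n + 1 + \<gamma>))
           * (\<Sum>j = 0..n. (-1) ^ j * real (n choose j)
                * (pochhammer (2 * real n + 1 + \<alpha> + \<gamma>) (n - j)
                   / (Gamma (\<alpha> + real n + 1 - real j) * pochhammer (\<alpha> - \<beta> + 1 - real j) n))
                * x ^ (n - j)))
     \<and> (\<forall>n::nat. n \<ge> 1 \<longrightarrow> (\<forall>x::real. poly (JP2 \<alpha> \<beta> \<gamma> (n + 1, n)) x =
           (-1) ^ (n - 1)
           * (Gamma (3 * real n + 1 + \<beta> + \<gamma>) * pochhammer (2 * real n + 1 + \<alpha> + \<gamma>) (n + 1)
             / (fact (n - 1) * Gamma (2 * real n + 1 + \<gamma>)))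
           * (\<Sum>j = 0..n - 1. (-1) ^ j * real ((n - 1) choose j)
                * (pochhammer (2 * real n + 1 + \<beta> + \<gamma>) (n - 1 - j)
                   / (Gamma (\<beta> + real n - real j)
                      * pochhammer (\<alpha> - \<beta> - (real n - 1) + real j) (n + 1)))
                * x ^ (n - 1 - j))))"
proof (intro conjI allI impI)
  have \<beta>\<alpha>: "\<beta> - \<alpha> \<notin> \<int>"
    using assms(4) Ints_minus[of "\<beta> - \<alpha>"] by auto
  have JP1_eq: "JP1 \<alpha> \<beta> \<gamma> (n, m) = jp_poly \<alpha> \<beta> \<gamma> n m"
    and JP2_eq: "JP2 \<alpha> \<beta> \<gamma> (n, m) = jp_poly \<beta> \<alpha> \<gamma> m n"
    and JP2_swap: "JP2 \<beta> \<alpha> \<gamma> (n, m) = jp_poly \<alpha> \<beta> \<gamma> m n" for n m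
    using assms \<beta>\<alpha> by (simp_all add: JP1_def JP2_def jacobi_pineiro_I_eq)
  {
    fix n :: nat assume n: "n \<ge> 1"
    show "JP1 \<alpha> \<beta> \<gamma> (n, n) = JP2 \<beta> \<alpha> \<gamma> (n, n)"
      by (simp add: JP1_eq JP2_swap)
    fix x :: real
    define z where "z = 2 * real n + \<alpha> + \<gamma>"
    have "z > 0" using assms n by (simp add: z_def)
    \<comment> \<open>Both sides equal
      \<open>pochhammer z n * pochhammer z (n - 1 - j) * Gamma z\<close>. This exchanges the
      constant Gamma factor for one that depends on \<open>j\<close>, as the diagonal formula
      demands.\<close>
    have shift: "Gamma (3 * real n + \<alpha> + \<gamma>) * pochhammer z (n - 1 - j) =
        pochhammer z n * Gamma (3 * real n - (real j + 1) + \<alpha> + \<gamma>)" if "j \<in> {0..n - 1}" for j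
    proof -
      have "3 * real n + \<alpha> + \<gamma> = z + real n"
        and "3 * real n - (real j + 1) + \<alpha> + \<gamma> = z + real (n - 1 - j)"
        using that n by (auto simp: z_def of_nat_diff)
      then show ?thesis
        by (simp only: Gamma_pochhammer[OF \<open>z > 0\<close>] mult_ac)
    qed
    have "poly (JP1 \<alpha> \<beta> \<gamma> (n, n)) x =
        pochhammer (2 * real n + \<beta> + \<gamma>) n / (fact (n - 1) * Gamma (2 * real n + \<gamma>))
          * (\<Sum>j = 0..n - 1. (-1) ^ j * real ((n - 1) choose j)
            * (Gamma (3 * real n + \<alpha> + \<gamma>) * pochhammer z (n - 1 - j)
              / (Gamma (real n - real j + \<alpha>) * pochhammer (\<alpha> - \<beta> - real j) n)) * x ^ (n - 1 - j))"
      by (simp add: JP1_eq poly_jp_poly[OF n] z_def sum_distrib_left algebra_simps)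
    also have "\<dots> = pochhammer z n * pochhammer (2 * real n + \<beta> + \<gamma>) n
             / (fact (n - 1) * Gamma (2 * real n + \<gamma>))
           * (\<Sum>j = 0..n - 1. (-1) ^ j * real ((n - 1) choose j)
                * (Gamma (3 * real n - (real j + 1) + \<alpha> + \<gamma>)
                   / (Gamma (real n - real j + \<alpha>) * pochhammer (\<alpha> - \<beta> - real j) n))
                * x ^ (n - 1 - j))"
      unfolding sum_distrib_left by (intro sum.cong refl) (simp only: shift, simp)
    finally show "poly (JP1 \<alpha> \<beta> \<gamma> (n, n)) x =
           pochhammer (2 * real n + \<alpha> + \<gamma>) n * pochhammer (2 * real n + \<beta> + \<gamma>) n
             / (fact (n - 1) * Gamma (2 * real n + \<gamma>))
           * (\<Sum>j = 0..n - 1. (-1) ^ j * real ((n - 1) choose j)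
                * (Gamma (3 * real n - (real j + 1) + \<alpha> + \<gamma>)
                   / (Gamma (real n - real j + \<alpha>) * pochhammer (\<alpha> - \<beta> - real j) n))
                * x ^ (n - 1 - j))"
      by (simp only: z_def)
  next
    fix n :: nat and x :: real
    have params: "2 * real (n + 1) + real n + \<alpha> + \<gamma> = 3 * real n + 2 + \<alpha> + \<gamma>"
      "real (n + 1) + real n + \<alpha> + \<gamma> = 2 * real n + 1 + \<alpha> + \<gamma>"
      "real (n + 1) + real n + \<beta> + \<gamma> = 2 * real n + 1 + \<beta> + \<gamma>"
      "real (n + 1) + real n + \<gamma> = 2 * real n + 1 + \<gamma>"
      "n + 1 - 1 = n"
      "\<alpha> + real (n + 1) - real j = \<alpha> + real n + 1 - real j"
      "\<alpha> - \<beta> + real (n + 1) - real n - real j = \<alpha> - \<beta> + 1 - real j" for j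
      by simp_all
    show "poly (JP1 \<alpha> \<beta> \<gamma> (n + 1, n)) x =
           Gamma (3 * real n + 2 + \<alpha> + \<gamma>) * pochhammer (2 * real n + 1 + \<beta> + \<gamma>) n
             / (fact n * Gamma (2 * real n + 1 + \<gamma>))
           * (\<Sum>j = 0..n. (-1) ^ j * real (n choose j)
                * (pochhammer (2 * real n + 1 + \<alpha> + \<gamma>) (n - j)
                   / (Gamma (\<alpha> + real n + 1 - real j) * pochhammer (\<alpha> - \<beta> + 1 - real j) n))
                * x ^ (n - j))"
      using poly_jp_poly[of "n + 1" \<alpha> \<beta> \<gamma> n x] unfolding JP1_eq params by simp
  next
    fix n :: nat and x :: real assume n: "n \<ge> 1"
    have params: "2 * real n + real (n + 1) + \<beta> + \<gamma> = 3 * real n + 1 + \<beta> + \<gamma>"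
      "real n + real (n + 1) + \<alpha> + \<gamma> = 2 * real n + 1 + \<alpha> + \<gamma>"
      "real n + real (n + 1) + \<beta> + \<gamma> = 2 * real n + 1 + \<beta> + \<gamma>"
      "real n + real (n + 1) + \<gamma> = 2 * real n + 1 + \<gamma>"
      by simp_all
    \<comment> \<open>A sign is its own inverse, and \<open>n + 1\<close> has the parity of
      \<open>n - 1\<close>; \<open>n \<ge> 1\<close> keeps the subtraction from being
      truncated.\<close>
    have sign: "a / (b * ((-1) ^ (n + 1) * c)) = (-1) ^ (n - 1) * (a / (b * c))" for a b c :: real
      using n by (cases "even n") auto
    \<comment> \<open>Exchanging the parameters leaves \<open>\<beta> - \<alpha>\<close> in the
      denominator; reflection restores \<open>\<alpha> - \<beta>\<close> and accounts for the sign
      in front of the formula.\<close>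
    have reflect: "pochhammer (\<beta> - \<alpha> + real n - real (n + 1) - real j) (n + 1) =
        (-1) ^ (n + 1) * pochhammer (\<alpha> - \<beta> - (real n - 1) + real j) (n + 1)" for j
      using pochhammer_minus[of "\<alpha> - \<beta> + 1 + real j" "n + 1"] by (simp add: algebra_simps)
    show "poly (JP2 \<alpha> \<beta> \<gamma> (n + 1, n)) x =
           (-1) ^ (n - 1)
           * (Gamma (3 * real n + 1 + \<beta> + \<gamma>) * pochhammer (2 * real n + 1 + \<alpha> + \<gamma>) (n + 1)
             / (fact (n - 1) * Gamma (2 * real n + 1 + \<gamma>)))
           * (\<Sum>j = 0..n - 1. (-1) ^ j * real ((n - 1) choose j)
                * (pochhammer (2 * real n + 1 + \<beta> + \<gamma>) (n - 1 - j)
                   / (Gamma (\<beta> + real n - real j)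
                      * pochhammer (\<alpha> - \<beta> - (real n - 1) + real j) (n + 1)))
                * x ^ (n - 1 - j))"
      unfolding JP2_eq poly_jp_poly[OF n] params reflect sign sum_distrib_left
      by (intro sum.cong refl) (simp only: mult_ac)
  }
qed

end
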